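(* Let $k\ge1$ and $n\ge 2k$. Then $-k$ is the smallest eigenvalue of the arrangement graph $A(n,k)$, and its multiplicity is at least $n(n-1)\cdots(n-k+2)(n-2k+1)$.
   Context: A $k$-permutation of $[n]=\{1,\dots,n\}$ is an injective map $\pi:\{1,\dots,k\}\to[n]$. The arrangement graph $A(n,k)$ has as vertices all $k$-permutations of $[n]$, two being adjacent iff they differ in exactly one position $i\in\{1,\dots,k\}$. Eigenvalues of a graph are those of its adjacency matrix. For $k=1$ the product $n(n-1)\cdots(n-k+2)$ is empty and equals $1$. *)

theory Defs
  imports
    "Graph_Theory.Pair_Digraph"
    "Jordan_Normal_Form.Char_Poly"
    "Jordan_Normal_Form.Matrix_Kernel"
begin

definition k_permutations :: "nat \<Rightarrow> nat \<Rightarrow> (nat \<Rightarrow> nat) set" where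
  "k_permutations n k = {\<pi> \<in> {1..k} \<rightarrow>\<^sub>E {1..n}. inj_on \<pi> {1..k}}"

text \<open>An undirected graph is a digraph with a symmetric irreflexive arc relation, each edge
  being represented by its two orientations (locale \<open>pair_graph\<close>).\<close>

definition arrangement_graph :: "nat \<Rightarrow> nat \<Rightarrow> (nat \<Rightarrow> nat) pair_pre_digraph" where
  "arrangement_graph n k =
    \<lparr>pverts = k_permutations n k,
     parcs = {(\<pi>, \<sigma>). \<pi> \<in> k_permutations n k \<and> \<sigma> \<in> k_permutations n k \<and>
                      (\<exists>!i. i \<in> {1..k} \<and> \<pi> i \<noteq> \<sigma> i)}\<rparr>"

lemma pair_graph_arrangement_graph: "pair_graph (arrangement_graph n k)"
proof -
  have "finite ({1..k} \<rightarrow>\<^sub>E {1..n})"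
    by (intro finite_PiE) auto
  then have fin: "finite (k_permutations n k)"
    by (auto simp: k_permutations_def)
  have arcs: "(\<pi>, \<sigma>) \<in> parcs (arrangement_graph n k) \<longleftrightarrow>
      \<pi> \<in> k_permutations n k \<and> \<sigma> \<in> k_permutations n k \<and> (\<exists>!i. i \<in> {1..k} \<and> \<pi> i \<noteq> \<sigma> i)" for \<pi> \<sigma>
    unfolding arrangement_graph_def by simp
  have verts: "pverts (arrangement_graph n k) = k_permutations n k"
    unfolding arrangement_graph_def by simp
  have sub: "parcs (arrangement_graph n k) \<subseteq> k_permutations n k \<times> k_permutations n k"
    using arcs by auto
  have swap: "(\<exists>!i. i \<in> {1..k} \<and> \<pi> i \<noteq> \<sigma> i) \<Longrightarrow> (\<exists>!i. i \<in> {1..k} \<and> \<sigma> i \<noteq> \<pi> i)"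
    for \<pi> \<sigma> :: "nat \<Rightarrow> nat"
    by metis
  have sym: "sym (parcs (arrangement_graph n k))"
  proof (rule symI)
    fix \<pi> \<sigma>
    assume "(\<pi>, \<sigma>) \<in> parcs (arrangement_graph n k)"
    then show "(\<sigma>, \<pi>) \<in> parcs (arrangement_graph n k)"
      unfolding arcs by (elim conjE) (rule conjI, assumption, rule conjI, assumption, rule swap)
  qed
  have loopfree: "fst e \<noteq> snd e" if "e \<in> parcs (arrangement_graph n k)" for e
  proof
    assume "fst e = snd e"
    then have "(fst e, fst e) \<in> parcs (arrangement_graph n k)"
      using that by (metis prod.collapse)
    then show False
      unfolding arcs by blast
  qed
  show ?thesis
  proof
    show "finite (pverts (arrangement_graph n k))"
      unfolding verts by (rule fin)
    show "finite (parcs (arrangement_graph n k))"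
      by (rule finite_subset[OF sub finite_cartesian_product[OF fin fin]])
    show "symmetric (with_proj (arrangement_graph n k))"
      unfolding symmetric_def with_proj_simps by (rule sym)
  next
    fix e
    assume e: "e \<in> parcs (arrangement_graph n k)"
    show "fst e \<in> pverts (arrangement_graph n k)" "snd e \<in> pverts (arrangement_graph n k)"
      unfolding verts using sub e by (auto simp del: One_nat_def)
    show "fst e \<noteq> snd e"
      using e by (rule loopfree)
  qed
qed

text \<open>Rows and columns are indexed by the positions of a list \<open>vs\<close> that is meant to enumerate
  the vertices without repetition.\<close>

definition adjacency_matrix :: "'a pair_pre_digraph \<Rightarrow> 'a list \<Rightarrow> real mat" where
  "adjacency_matrix G vs =
    mat (length vs) (length vs) (\<lambda>(i, j). of_bool ((vs ! i, vs ! j) \<in> parcs G))"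

text \<open>Multiplicity is the dimension of the eigenspace; the adjacency matrix of an undirected
  graph is real symmetric, so this equals the multiplicity as a root of the characteristic
  polynomial.\<close>

definition eigenvalue_multiplicity :: "'a :: field mat \<Rightarrow> 'a \<Rightarrow> nat" where
  "eigenvalue_multiplicity A \<mu> = kernel_dim (char_matrix A \<mu>)"

end

theory Submission
  imports Defs
begin

text \<open>Call a pair of a position \<open>i\<close> and an injective map \<open>\<tau>\<close> from the other positions a flag,
  and let \<open>N\<close> be the incidence matrix whose rows are flags and whose columns are vertices,
  \<open>\<pi>\<close> being incident with \<open>(i, \<tau>)\<close> iff it extends \<open>\<tau>\<close>. Two distinct vertices lie on a common
  flag iff they are adjacent, and then on exactly one, while each vertex lies on \<open>k\<close> flags; so the
  adjacency matrix \<open>A\<close> satisfies \<open>A + k I = N\<^sup>T N\<close>. Hence \<open>A + k I\<close> is positive semidefinite with the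
  same kernel as \<open>N\<close>, whose dimension is at least the number of vertices minus the number of
  flags. With \<open>P = n (n - 1) \<dots> (n - k + 2)\<close> this difference is
  \<open>P (n - k + 1) - k P = P (n - 2 k + 1) > 0\<close>.\<close>

section \<open>Kernels and Gram matrices\<close>

text \<open>Gauss-Jordan elimination multiplies by an invertible matrix from the left and so keeps
  the kernel. It makes the explicit kernel basis of an echelon form available for an arbitrary
  \<open>A\<close>.\<close>

lemma kernel_dim_eq_find_base_vectors:
  fixes A :: "'a :: field mat"
  assumes A: "A \<in> carrier_mat nr nc"
  obtains C where "C \<in> carrier_mat nr nc" "row_echelon_form C" "mat_kernel C = mat_kernel A"
    "kernel_dim A = card (set (find_base_vectors C))"
proof -
  obtain C where gj: "gauss_jordan_single A = C" by auto
  from gauss_jordan_single[OF A gj] obtain P Q where CPA: "C = P * A" and QP: "Q * P = 1\<^sub>m nr"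
    and P: "P \<in> carrier_mat nr nr" and Q: "Q \<in> carrier_mat nr nr"
    and C: "C \<in> carrier_mat nr nc" and row: "row_echelon_form C"
    by auto
  have ker: "mat_kernel C = mat_kernel A"
    unfolding CPA by (rule mat_kernel_mult_eq[OF A P Q QP])
  have "kernel_dim A = card (set (find_base_vectors C))"
    using find_base_vectors(4,6)[OF row C] A by (simp add: kernel_dim_def ker)
  with C row ker show thesis by (rule that)
qed

text \<open>Rank-nullity: the basis has one vector for each column, less the number of nonzero rows
  of the echelon form, and there are at most \<open>nr\<close> such rows.\<close>

lemma kernel_dim_ge:
  fixes A :: "'a :: field mat"
  assumes "A \<in> carrier_mat nr nc"
  shows "nc - nr \<le> kernel_dim A"
proof -
  obtain C :: "'a mat" where C: "C \<in> carrier_mat nr nc" "row_echelon_form C"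
    and dim: "kernel_dim A = card (set (find_base_vectors C))"
    using kernel_dim_eq_find_base_vectors[OF assms] by blast
  have "card {i. i < nr \<and> row C i \<noteq> 0\<^sub>v nc} \<le> card {..<nr}"
    by (rule card_mono) auto
  with find_base_vectors(4)[OF C(2,1)] dim show ?thesis by simp
qed

lemma kernel_dim_pos_imp_nonzero:
  fixes A :: "'a :: field mat"
  assumes A: "A \<in> carrier_mat nr nc" and pos: "kernel_dim A > 0"
  obtains v where "v \<in> mat_kernel A" "v \<noteq> 0\<^sub>v nc"
proof -
  obtain C :: "'a mat" where C: "C \<in> carrier_mat nr nc" "row_echelon_form C"
    and ker: "mat_kernel C = mat_kernel A"
    and dim: "kernel_dim A = card (set (find_base_vectors C))"
    by (rule kernel_dim_eq_find_base_vectors[OF A])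
  from pos dim have "set (find_base_vectors C) \<noteq> {}" by auto
  then obtain v where v: "v \<in> set (find_base_vectors C)" using ex_in_conv by metis
  have "v \<in> mat_kernel A" using find_base_vectors(1)[OF C(2,1)] v ker by auto
  moreover have "v \<noteq> 0\<^sub>v nc" using find_base_vectors(2)[OF C(2,1)] v by metis
  ultimately show thesis by (rule that)
qed

lemma eigenvalue_if_kernel_dim_pos:
  fixes A :: "'a :: field mat"
  assumes A: "A \<in> carrier_mat m m" and pos: "kernel_dim (char_matrix A c) > 0"
  shows "eigenvalue A c"
proof -
  have cA: "char_matrix A c \<in> carrier_mat m m" using A by simp
  obtain v where v: "v \<in> mat_kernel (char_matrix A c)" "v \<noteq> 0\<^sub>v m"
    using kernel_dim_pos_imp_nonzero[OF cA pos] .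
  with mat_kernelD[OF cA v(1)] show ?thesis
    unfolding eigenvalue_char_matrix[OF A] by blast
qed

lemma scalar_prod_self_nonneg: "(v :: real vec) \<bullet> v \<ge> 0"
  by (auto simp: scalar_prod_def intro: sum_nonneg)

lemma scalar_prod_self_eq_0_iff:
  assumes "(v :: real vec) \<in> carrier_vec n"
  shows "v \<bullet> v = 0 \<longleftrightarrow> v = 0\<^sub>v n"
  using assms by (auto simp: scalar_prod_def sum_nonneg_eq_0_iff)

lemma scalar_prod_gram:
  fixes N :: "real mat"
  assumes N: "N \<in> carrier_mat nr nc" and v: "v \<in> carrier_vec nc"
  shows "v \<bullet> ((N\<^sup>T * N) *\<^sub>v v) = (N *\<^sub>v v) \<bullet> (N *\<^sub>v v)"
proof -
  have Nv: "N *\<^sub>v v \<in> carrier_vec nr" using N v by simp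
  have "(N\<^sup>T * N) *\<^sub>v v = N\<^sup>T *\<^sub>v (N *\<^sub>v v)"
    using N v by (intro assoc_mult_mat_vec) auto
  moreover have "N\<^sup>T *\<^sub>v (N *\<^sub>v v) \<in> carrier_vec nc" using N Nv by simp
  ultimately show ?thesis
    using transpose_vec_mult_scalar[OF N v Nv] v by (simp add: comm_scalar_prod)
qed

text \<open>Over the reals, a vector killed by the Gram matrix satisfies (N v) . (N v) = v . (N^T N
  v) = 0, which forces N v = 0.\<close>

lemma mat_kernel_gram:
  fixes N :: "real mat"
  assumes N: "N \<in> carrier_mat nr nc"
  shows "mat_kernel (N\<^sup>T * N) = mat_kernel N"
proof
  show "mat_kernel N \<subseteq> mat_kernel (N\<^sup>T * N)"
    using N by (intro mat_kernel_mult_subset) auto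
  show "mat_kernel (N\<^sup>T * N) \<subseteq> mat_kernel N"
  proof
    fix v assume v: "v \<in> mat_kernel (N\<^sup>T * N)"
    have G: "N\<^sup>T * N \<in> carrier_mat nc nc" using N by simp
    note vD = mat_kernelD[OF G v]
    have Nv: "N *\<^sub>v v \<in> carrier_vec nr" using N vD by simp
    have "(N *\<^sub>v v) \<bullet> (N *\<^sub>v v) = 0"
      using scalar_prod_gram[OF N vD(1)] vD by simp
    then show "v \<in> mat_kernel N"
      using scalar_prod_self_eq_0_iff[OF Nv] mat_kernelI[OF N vD(1)] by simp
  qed
qed

text \<open>Since \<open>char_matrix A c\<close> is A - c I, its quadratic form at an eigenvector v
  for \<mu> is (\<mu> - c) (v . v); as a Gram form it is also (N v) . (N v), hence
  nonnegative.\<close>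

lemma eigenvalue_ge_if_char_matrix_gram:
  fixes A N :: "real mat"
  assumes A: "A \<in> carrier_mat m m" and N: "N \<in> carrier_mat nr m"
    and gram: "char_matrix A c = N\<^sup>T * N" and ev: "eigenvalue A \<mu>"
  shows "c \<le> \<mu>"
proof -
  obtain v where v: "v \<in> carrier_vec m" "v \<noteq> 0\<^sub>v m" and Av: "A *\<^sub>v v = \<mu> \<cdot>\<^sub>v v"
    using ev A unfolding eigenvalue_def eigenvector_def by auto
  have "char_matrix A c *\<^sub>v v = A *\<^sub>v v + (- c) \<cdot>\<^sub>v v"
    unfolding char_matrix_def using A v
    by (subst add_mult_distrib_mat_vec[of _ m m]) auto
  also have "\<dots> = (\<mu> - c) \<cdot>\<^sub>v v"
    unfolding Av using v by (intro eq_vecI) (auto simp: algebra_simps)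
  finally have "v \<bullet> ((N\<^sup>T * N) *\<^sub>v v) = (\<mu> - c) * (v \<bullet> v)"
    using v gram by simp
  then have "0 \<le> (\<mu> - c) * (v \<bullet> v)"
    using scalar_prod_gram[OF N v(1)] scalar_prod_self_nonneg[of "N *\<^sub>v v"] by simp
  moreover have "v \<bullet> v > 0"
    using scalar_prod_self_nonneg[of v] scalar_prod_self_eq_0_iff[OF v(1)] v(2) by simp
  ultimately show ?thesis
    by (simp add: zero_le_mult_iff)
qed

section \<open>Vertices and flags of the arrangement graph\<close>

text \<open>A general domain \<open>S\<close> covers both the vertices and their restrictions to all
  positions but one. Extensionality lets a restriction be compared with a flag by plain
  equality.\<close>

definition partial_permutations :: "nat \<Rightarrow> nat set \<Rightarrow> (nat \<Rightarrow> nat) set" where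
  "partial_permutations n S = {f \<in> S \<rightarrow>\<^sub>E {1..n}. inj_on f S}"

definition flags :: "nat \<Rightarrow> nat \<Rightarrow> (nat \<times> (nat \<Rightarrow> nat)) set" where
  "flags n k = (SIGMA i:{1..k}. partial_permutations n ({1..k} - {i}))"

lemma finite_partial_permutations: "finite S \<Longrightarrow> finite (partial_permutations n S)"
  unfolding partial_permutations_def
  by (rule finite_subset[OF _ finite_PiE[of S "\<lambda>_. {1..n}"]]) auto

text \<open>Truncated subtraction gives the right value also for \<open>card S > n\<close>: the
  factor with \<open>i = n\<close> is 0, and no injection exists.\<close>

lemma card_partial_permutations:
  "finite S \<Longrightarrow> card (partial_permutations n S) = (\<Prod>i<card S. n - i)"
  using card_inj_on_subset_funcset[of S "{1..n}" S]
  by (simp add: partial_permutations_def atLeast0LessThan)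

lemma finite_flags: "finite (flags n k)"
  unfolding flags_def by (intro finite_SigmaI finite_partial_permutations) auto

lemma card_flags: "card (flags n k) = k * (\<Prod>i<k - 1. n - i)"
  unfolding flags_def
  by (subst card_SigmaI) (auto simp: card_partial_permutations finite_partial_permutations)

lemma card_k_permutations: "card (k_permutations n k) = (\<Prod>i<k. n - i)"
  using card_partial_permutations[of "{1..k}" n]
  by (simp add: k_permutations_def partial_permutations_def)

text \<open>The restrictions away from i agree iff f and g differ at most at i. For distinct f and g
  such an i must be their only point of difference.\<close>

lemma card_agree_off_one:
  assumes "finite S" "f \<in> extensional S" "g \<in> extensional S"
  shows "card {i \<in> S. restrict f (S - {i}) = restrict g (S - {i})} =
    (if f = g then card S else of_bool (\<exists>!i. i \<in> S \<and> f i \<noteq> g i))"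
proof (cases "f = g")
  case False
  \<comment> \<open>Both maps are extensional on \<open>S\<close>, so they can only differ inside
    it.\<close>
  then obtain j where j: "j \<in> S" "f j \<noteq> g j"
    using assms(2,3) by (meson extensionalityI)
  have iff: "restrict f (S - {i}) = restrict g (S - {i}) \<longleftrightarrow> (\<forall>l\<in>S - {i}. f l = g l)" for i
    by (auto simp: fun_eq_iff restrict_def)
  show ?thesis
  proof (cases "\<exists>!i. i \<in> S \<and> f i \<noteq> g i")
    case True
    then have "{i \<in> S. restrict f (S - {i}) = restrict g (S - {i})} = {j}"
      unfolding iff using j by blast
    with True False show ?thesis by simp
  next
    case nu: False
    then have "{i \<in> S. restrict f (S - {i}) = restrict g (S - {i})} = {}"
      unfolding iff using j by blast
    then have "card {i \<in> S. restrict f (S - {i}) = restrict g (S - {i})} = 0"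
      by (simp only: card.empty)
    with nu False show ?thesis by simp
  qed
qed simp

text \<open>This is the entry of the Gram matrix at the columns \<pi> and \<sigma>.\<close>

lemma card_common_flags:
  assumes \<pi>: "\<pi> \<in> k_permutations n k" and \<sigma>: "\<sigma> \<in> k_permutations n k"
  shows "card {(i, \<tau>) \<in> flags n k. restrict \<pi> ({1..k} - {i}) = \<tau> \<and> restrict \<sigma> ({1..k} - {i}) = \<tau>} =
    (if \<pi> = \<sigma> then k else of_bool ((\<pi>, \<sigma>) \<in> parcs (arrangement_graph n k)))"
    (is "card ?F = _")
proof -
  let ?r = "\<lambda>i. restrict \<pi> ({1..k} - {i})"
  have \<pi>_map: "\<pi> \<in> {1..k} \<rightarrow> {1..n}" and \<pi>_inj: "inj_on \<pi> {1..k}"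
    using \<pi> by (simp_all add: k_permutations_def PiE_def)
  have "?r i \<in> partial_permutations n ({1..k} - {i})" for i
    using Pi_mem[OF \<pi>_map] inj_on_subset[OF \<pi>_inj, of "{1..k} - {i}"]
    unfolding partial_permutations_def by (simp add: restrict_PiE_iff)
  \<comment> \<open>The position determines a common flag, because its map must be the restriction
    of \<pi>; so it suffices to count positions.\<close>
  then have "?F = (\<lambda>i. (i, ?r i)) ` {i \<in> {1..k}. ?r i = restrict \<sigma> ({1..k} - {i})}"
    by (auto simp: flags_def) metis
  then have "card ?F = card {i \<in> {1..k}. ?r i = restrict \<sigma> ({1..k} - {i})}"
    by (simp add: card_image inj_on_def)
  also have "\<dots> = (if \<pi> = \<sigma> then k else of_bool (\<exists>!i. i \<in> {1..k} \<and> \<pi> i \<noteq> \<sigma> i))"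
    using \<pi> \<sigma> by (subst card_agree_off_one) (auto simp: k_permutations_def PiE_def)
  finally show ?thesis
    using \<pi> \<sigma> by (simp add: arrangement_graph_def)
qed

definition flag_matrix :: "nat \<Rightarrow> (nat \<times> (nat \<Rightarrow> nat)) list \<Rightarrow> (nat \<Rightarrow> nat) list \<Rightarrow> real mat" where
  "flag_matrix k fs vs = mat (length fs) (length vs)
    (\<lambda>(a, b). of_bool (restrict (vs ! b) ({1..k} - {fst (fs ! a)}) = snd (fs ! a)))"

lemma char_matrix_arrangement_graph:
  assumes vs: "distinct vs" "set vs = k_permutations n k"
    and fs: "distinct fs" "set fs = flags n k"
  shows "char_matrix (adjacency_matrix (arrangement_graph n k) vs) (- real k) =
    (flag_matrix k fs vs)\<^sup>T * flag_matrix k fs vs"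
    (is "?L = ?N\<^sup>T * ?N")
proof (rule eq_matI)
  show "dim_row ?L = dim_row (?N\<^sup>T * ?N)" "dim_col ?L = dim_col (?N\<^sup>T * ?N)"
    by (simp_all add: char_matrix_def adjacency_matrix_def flag_matrix_def)
  fix b c assume "b < dim_row (?N\<^sup>T * ?N)" "c < dim_col (?N\<^sup>T * ?N)"
  then have b: "b < length vs" and c: "c < length vs"
    by (simp_all add: flag_matrix_def)
  let ?\<pi> = "vs ! b" and ?\<sigma> = "vs ! c"
  have mem: "?\<pi> \<in> k_permutations n k" "?\<sigma> \<in> k_permutations n k"
    using b c vs by (metis nth_mem)+
  let ?P = "\<lambda>x. restrict ?\<pi> ({1..k} - {fst x}) = snd x \<and> restrict ?\<sigma> ({1..k} - {fst x}) = snd x"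
  \<comment> \<open>A product of two 0/1 incidences is the indicator of their conjunction.\<close>
  have "(?N\<^sup>T * ?N) $$ (b, c) = (\<Sum>a<length fs. of_bool (?P (fs ! a)))"
    using b c by (simp add: flag_matrix_def scalar_prod_def of_bool_conj atLeast0LessThan)
  also have "\<dots> = (\<Sum>x\<in>flags n k. of_bool (?P x))"
    using sum.reindex_bij_betw[OF bij_betw_nth[OF fs(1) refl fs(2)[symmetric]],
        of "\<lambda>x. of_bool (?P x)"] .
  also have "\<dots> = real (card {x \<in> flags n k. ?P x})"
    using finite_flags[of n k] by (simp add: of_bool_def sum.If_cases Int_def)
  also have "{x \<in> flags n k. ?P x} =
      {(i, \<tau>) \<in> flags n k. restrict ?\<pi> ({1..k} - {i}) = \<tau> \<and> restrict ?\<sigma> ({1..k} - {i}) = \<tau>}"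
    by auto
  also have "real (card \<dots>) =
      (if b = c then real k else of_bool ((?\<pi>, ?\<sigma>) \<in> parcs (arrangement_graph n k)))"
    using card_common_flags[OF mem] nth_eq_iff_index_eq[OF vs(1) b c] by simp
  \<comment> \<open>There are no loops, so on the diagonal only the k from subtracting -k I
    remains.\<close>
  also have "\<dots> = ?L $$ (b, c)"
    using b c by (auto simp: char_matrix_def adjacency_matrix_def arrangement_graph_def)
  finally show "?L $$ (b, c) = (?N\<^sup>T * ?N) $$ (b, c)" by simp
qed

theorem theorem14:
  fixes n k :: nat and vs :: "(nat \<Rightarrow> nat) list"
  assumes "k \<ge> 1" and "n \<ge> 2 * k"
    and "distinct vs" and "set vs = pverts (arrangement_graph n k)"
  shows "eigenvalue (adjacency_matrix (arrangement_graph n k) vs) (- real k) \<and>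
    (\<forall>\<mu>. eigenvalue (adjacency_matrix (arrangement_graph n k) vs) \<mu> \<longrightarrow> - real k \<le> \<mu>) \<and>
    (\<Prod>i<k - 1. n - i) * (n - 2 * k + 1)
      \<le> eigenvalue_multiplicity (adjacency_matrix (arrangement_graph n k) vs) (- real k)"
proof -
  let ?A = "adjacency_matrix (arrangement_graph n k) vs" and ?P = "\<Prod>i<k - 1. n - i"
  have vs: "set vs = k_permutations n k"
    using assms(4) by (simp add: arrangement_graph_def)
  obtain fs where fs: "distinct fs" "set fs = flags n k"
    using finite_distinct_list[OF finite_flags] by metis
  let ?N = "flag_matrix k fs vs"
  have A: "?A \<in> carrier_mat (length vs) (length vs)"
    by (simp add: adjacency_matrix_def)
  have N: "?N \<in> carrier_mat (length fs) (length vs)"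
    by (simp add: flag_matrix_def)
  note gram = char_matrix_arrangement_graph[OF assms(3) vs fs]
  \<comment> \<open>\<open>kernel_dim\<close> depends only on the kernel and the number of columns,
    and the Gram matrix shares both with \<open>?N\<close>.\<close>
  have mult: "eigenvalue_multiplicity ?A (- real k) = kernel_dim ?N"
    using N by (simp add: eigenvalue_multiplicity_def gram kernel_dim_def mat_kernel_gram[OF N])
  have "length fs = k * ?P"
    using distinct_card[OF fs(1)] fs(2) card_flags by simp
  moreover have "length vs = ?P * (n - (k - 1))"
  proof -
    \<comment> \<open>Writing k as \<open>Suc (k - 1)\<close> splits off the last factor, so that
      \<open>?P\<close> appears in both counts.\<close>
    have "length vs = (\<Prod>i<Suc (k - 1). n - i)"
      using distinct_card[OF assms(3)] vs card_k_permutations assms(1) by simp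
    then show ?thesis by simp
  qed
  \<comment> \<open>By n \<ge> 2k no subtraction is truncated; the summand k cancels against the k
    \<open>?P\<close> flags.\<close>
  moreover have "n - (k - 1) = (n - 2 * k + 1) + k"
    using assms(1,2) by simp
  ultimately have "length vs - length fs = ?P * (n - 2 * k + 1)"
    by (simp only: add_mult_distrib2 mult.commute[of k] diff_add_inverse2)
  with kernel_dim_ge[OF N] mult
  have bound: "?P * (n - 2 * k + 1) \<le> eigenvalue_multiplicity ?A (- real k)" by simp
  \<comment> \<open>With the successor \<open>n - 2 * k + 1\<close> as other factor, the bound is
    positive, so the eigenspace of -k is nontrivial.\<close>
  have "?P > 0"
    using assms(2) by (intro prod_pos) auto
  with bound have "kernel_dim (char_matrix ?A (- real k)) > 0"
    unfolding eigenvalue_multiplicity_def by (metis less_le_trans nat_0_less_mult_iff zero_less_Suc Suc_eq_plus1)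
  with eigenvalue_if_kernel_dim_pos[OF A] have "eigenvalue ?A (- real k)" .
  with bound show ?thesis
    using eigenvalue_ge_if_char_matrix_gram[OF A N gram] by blast
qed

end
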